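(* Let $K\ge 2$, $Y=(Y_1,\dots,Y_K)'\in\mathbb{R}^K$, and $\sigma_1,\dots,\sigma_K>0$. Under the simplex class $\Lambda_\Delta=\Delta(\mathcal{V})$, with optimal headline $\hat\theta_\Delta^*(Y)$, optimized risk $R_\Delta^*(Y)$, and reconciliation cost $c_\Delta^*(Y)=\sqrt{R_\Delta^*(Y)-1}$ (see context), $$\hat\theta_\Delta^*(Y)=\max_{k\in[K]}\{Y_k-\sigma_kc_\Delta^*(Y)\}=\min_{k\in[K]}\{Y_k+\sigma_kc_\Delta^*(Y)\},\qquad R_\Delta^*(Y)=\left(\max_{j<k}\frac{|Y_j-Y_k|}{\sigma_j+\sigma_k}\right)^2+1.$$ If $(j^*,k^* )$ attains the pairwise maximum in the formula for $R_\Delta^*(Y)$, then $$\hat\theta_\Delta^*(Y)=\frac{\sigma_{k^*}Y_{j^*}+\sigma_{j^*}Y_{k^*}}{\sigma_{j^*}+\sigma_{k^*}},\qquad c_\Delta^*(Y)=D_{j^*}(\hat\theta_\Delta^*(Y)|Y)=D_{k^*}(\hat\theta_\Delta^*(Y)|Y)=\frac{|Y_{j^*}-Y_{k^*}|}{\sigma_{j^*}+\sigma_{k^*}}.$$ The reconciliation cost $c_\Delta^*(Y)$ is the smallest $c\ge 0$ such that the intervals $I_k(c)=[Y_k-c\sigma_k,\,Y_k+c\sigma_k]$, $k\in[K]$, have nonempty intersection. In particular, $$\bigcap_{k=1}^KI_k(c_\Delta^*(Y))=\{\hat\theta_\Delta^*(Y)\},\qquad c_\Delta^*(Y)=\min\Big\{c\ge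 0:\bigcap_{k=1}^KI_k(c)\ne\varnothing\Big\}.$$ For $K=2$, the solution is given by $(j^*,k^* )=(1,2)$, that is, $$\hat\theta_\Delta^*(Y)=\frac{\sigma_2Y_1+\sigma_1Y_2}{\sigma_1+\sigma_2},\qquad c_\Delta^*(Y)=D_1(\hat\theta_\Delta^*(Y)|Y)=D_2(\hat\theta_\Delta^*(Y)|Y)=\frac{|Y_1-Y_2|}{\sigma_1+\sigma_2},\qquad R_\Delta^*(Y)=\left(\frac{|Y_1-Y_2|}{\sigma_1+\sigma_2}\right)^2+1;$$ if moreover $Y_1\ne Y_2$, the unique least favorable prior is $\lambda^*=(p_\Delta,1-p_\Delta)'$, where $p_\Delta=\sigma_1/(\sigma_1+\sigma_2)$.
   Context: $[K]=\{1,\dots,K\}$ and $\Delta(\mathcal{V})=\{\lambda\in\mathbb{R}^K:\lambda\ge 0,\ \sum_{k=1}^K\lambda_k=1\}$. For $a\in\mathbb{R}$ let $D_k(a|Y)=|Y_k-a|/\sigma_k$ and $$R_\Delta(a|Y)=\max_{\lambda\in\Delta(\mathcal{V})}\sum_{k=1}^K\lambda_kD_k(a|Y)^2+1=\max_{k\in[K]}D_k(a|Y)^2+1.$$ The optimal headline is $\hat\theta_\Delta^*(Y)=\arg\min_{a\in\mathbb{R}}R_\Delta(a|Y)$ (the unique minimizer) and the optimized risk is $R_\Delta^*(Y)=\min_{a\in\mathbb{R}}R_\Delta(a|Y)$. For $\lambda\in\Delta(\mathcal{V})$ let $$a(\lambda|Y)=\frac{\sum_{k}\lambda_kY_k/\sigma_k^2}{\sum_{k}\lambda_k/\sigma_k^2},\qquad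 \rho(\lambda|Y)=\sum_{k}\lambda_kD_k(a(\lambda|Y)|Y)^2.$$ A least favorable prior (for the simplex class) is a maximizer of $\rho(\cdot|Y)$ over $\Delta(\mathcal{V})$. *)

theory Defs
  imports "HOL-Analysis.Analysis"
begin

text \<open>
  Vectors in \<open>\<real>\<^sup>K\<close> are functions \<open>nat \<Rightarrow> real\<close> read at the indices \<open>1, \<dots>, K\<close>. Priors are
  required to vanish outside \<open>{1..K}\<close>, so that two priors are equal as functions iff they are
  equal as vectors; this matters for uniqueness of the least favorable prior. The values of
  \<open>Y\<close> and \<open>\<sigma>\<close> outside \<open>{1..K}\<close> are never used.
\<close>

definition prior_simplex :: "nat \<Rightarrow> (nat \<Rightarrow> real) set" where
  "prior_simplex K =
     {l. (\<forall>k\<in>{1..K}. 0 \<le> l k) \<and> (\<forall>k. k \<notin> {1..K} \<longrightarrow> l k = 0) \<and> (\<Sum>k=1..K. l k) = 1}"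

definition std_dist :: "(nat \<Rightarrow> real) \<Rightarrow> (nat \<Rightarrow> real) \<Rightarrow> nat \<Rightarrow> real \<Rightarrow> real" where
  "std_dist \<sigma> Y k a = \<bar>Y k - a\<bar> / \<sigma> k"

definition simplex_risk :: "nat \<Rightarrow> (nat \<Rightarrow> real) \<Rightarrow> (nat \<Rightarrow> real) \<Rightarrow> real \<Rightarrow> real" where
  "simplex_risk K \<sigma> Y a = (SUP l\<in>prior_simplex K. \<Sum>k=1..K. l k * (std_dist \<sigma> Y k a)\<^sup>2) + 1"

definition optimal_headline :: "nat \<Rightarrow> (nat \<Rightarrow> real) \<Rightarrow> (nat \<Rightarrow> real) \<Rightarrow> real" where
  "optimal_headline K \<sigma> Y = (THE a. is_arg_min (simplex_risk K \<sigma> Y) (\<lambda>_. True) a)"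

definition optimized_risk :: "nat \<Rightarrow> (nat \<Rightarrow> real) \<Rightarrow> (nat \<Rightarrow> real) \<Rightarrow> real" where
  "optimized_risk K \<sigma> Y = (INF a. simplex_risk K \<sigma> Y a)"

definition reconciliation_cost :: "nat \<Rightarrow> (nat \<Rightarrow> real) \<Rightarrow> (nat \<Rightarrow> real) \<Rightarrow> real" where
  "reconciliation_cost K \<sigma> Y = sqrt (optimized_risk K \<sigma> Y - 1)"

definition prior_action :: "nat \<Rightarrow> (nat \<Rightarrow> real) \<Rightarrow> (nat \<Rightarrow> real) \<Rightarrow> (nat \<Rightarrow> real) \<Rightarrow> real" where
  "prior_action K \<sigma> Y l =
     (\<Sum>k=1..K. l k * Y k / (\<sigma> k)\<^sup>2) / (\<Sum>k=1..K. l k / (\<sigma> k)\<^sup>2)"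

definition prior_risk :: "nat \<Rightarrow> (nat \<Rightarrow> real) \<Rightarrow> (nat \<Rightarrow> real) \<Rightarrow> (nat \<Rightarrow> real) \<Rightarrow> real" where
  "prior_risk K \<sigma> Y l = (\<Sum>k=1..K. l k * (std_dist \<sigma> Y k (prior_action K \<sigma> Y l))\<^sup>2)"

definition least_favorable_prior ::
    "nat \<Rightarrow> (nat \<Rightarrow> real) \<Rightarrow> (nat \<Rightarrow> real) \<Rightarrow> (nat \<Rightarrow> real) \<Rightarrow> bool" where
  "least_favorable_prior K \<sigma> Y l \<longleftrightarrow>
     is_arg_max (prior_risk K \<sigma> Y) (\<lambda>m. m \<in> prior_simplex K) l"

definition pair_ratio :: "(nat \<Rightarrow> real) \<Rightarrow> (nat \<Rightarrow> real) \<Rightarrow> nat \<Rightarrow> nat \<Rightarrow> real" where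
  "pair_ratio \<sigma> Y j k = \<bar>Y j - Y k\<bar> / (\<sigma> j + \<sigma> k)"

definition max_pair_ratio :: "nat \<Rightarrow> (nat \<Rightarrow> real) \<Rightarrow> (nat \<Rightarrow> real) \<Rightarrow> real" where
  "max_pair_ratio K \<sigma> Y = Max {pair_ratio \<sigma> Y j k | j k. 1 \<le> j \<and> j < k \<and> k \<le> K}"

definition report_interval :: "(nat \<Rightarrow> real) \<Rightarrow> (nat \<Rightarrow> real) \<Rightarrow> nat \<Rightarrow> real \<Rightarrow> real set" where
  "report_interval \<sigma> Y k c = {Y k - c * \<sigma> k .. Y k + c * \<sigma> k}"

text \<open>
  The supremum in \<open>simplex_risk\<close> is a maximum, the minimizer in \<open>optimal_headline\<close>
  exists and is unique, and the infimum in \<open>optimized_risk\<close> is attained there.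
\<close>

lemma simplex_risk_is_max:
  assumes "K \<ge> 1"
  shows "\<exists>l\<in>prior_simplex K. simplex_risk K \<sigma> Y a = (\<Sum>k=1..K. l k * (std_dist \<sigma> Y k a)\<^sup>2) + 1"
    and "l \<in> prior_simplex K \<Longrightarrow> (\<Sum>k=1..K. l k * (std_dist \<sigma> Y k a)\<^sup>2) + 1 \<le> simplex_risk K \<sigma> Y a"
    and "simplex_risk K \<sigma> Y a = (MAX k\<in>{1..K}. (std_dist \<sigma> Y k a)\<^sup>2) + 1"
proof -
  define d where "d k = (std_dist \<sigma> Y k a)\<^sup>2" for k
  define M where "M = Max (d ` {1..K})"
  let ?f = "\<lambda>l. \<Sum>k=1..K. l k * d k"
  have "M \<in> d ` {1..K}"
    unfolding M_def using assms by (intro Max_in) auto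
  then obtain i where i: "i \<in> {1..K}" "d i = M" by auto
  define e where "e = (\<lambda>k. if k = i then 1 else 0 :: real)"
  have e: "e \<in> prior_simplex K"
    using i by (auto simp: prior_simplex_def e_def)
  have fe: "?f e = M"
  proof -
    have "?f e = (\<Sum>k=1..K. if k = i then d k else 0)"
      by (intro sum.cong) (auto simp: e_def)
    then show ?thesis using i by simp
  qed
  have le: "?f l \<le> M" if l: "l \<in> prior_simplex K" for l
  proof -
    have "?f l \<le> (\<Sum>k=1..K. l k * M)"
      using l by (intro sum_mono mult_left_mono) (auto simp: M_def prior_simplex_def)
    also have "\<dots> = M"
      using l by (simp add: prior_simplex_def flip: sum_distrib_right)
    finally show ?thesis .
  qed
  have "Sup (?f ` prior_simplex K) = M"
    using e fe le by (intro cSup_eq_maximum) (auto intro!: rev_image_eqI)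
  then have R: "simplex_risk K \<sigma> Y a = M + 1"
    by (simp add: simplex_risk_def d_def)
  show "\<exists>l\<in>prior_simplex K. simplex_risk K \<sigma> Y a = (\<Sum>k=1..K. l k * (std_dist \<sigma> Y k a)\<^sup>2) + 1"
    using e fe R by (auto simp: d_def)
  show "(\<Sum>k=1..K. l k * (std_dist \<sigma> Y k a)\<^sup>2) + 1 \<le> simplex_risk K \<sigma> Y a" if "l \<in> prior_simplex K"
    using le[OF that] R by (simp add: d_def)
  show "simplex_risk K \<sigma> Y a = (MAX k\<in>{1..K}. (std_dist \<sigma> Y k a)\<^sup>2) + 1"
    using R by (simp add: M_def d_def image_def)
qed

lemma continuous_on_Max_family:
  fixes f :: "'b \<Rightarrow> 'a::topological_space \<Rightarrow> real"
  assumes "finite I" "I \<noteq> {}" "\<And>i. i \<in> I \<Longrightarrow> continuous_on S (f i)"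
  shows "continuous_on S (\<lambda>x. MAX i\<in>I. f i x)"
  using assms
proof (induction I rule: finite_ne_induct)
  case (insert i I)
  then have "(\<lambda>x. MAX j\<in>insert i I. f j x) = (\<lambda>x. max (f i x) (MAX j\<in>I. f j x))"
    by simp
  then show ?case using insert by (auto intro!: continuous_on_max)
qed simp

lemma optimal_headline_unique:
  assumes K: "K \<ge> 1" and \<sigma>: "\<And>k. k \<in> {1..K} \<Longrightarrow> \<sigma> k > 0"
  shows "\<exists>!a. is_arg_min (simplex_risk K \<sigma> Y) (\<lambda>_. True) a"
proof -
  let ?R = "simplex_risk K \<sigma> Y"
  have R: "?R a = (MAX k\<in>{1..K}. (std_dist \<sigma> Y k a)\<^sup>2) + 1" for a
    by (rule simplex_risk_is_max(3)[OF K])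
  have ge: "(std_dist \<sigma> Y k a)\<^sup>2 + 1 \<le> ?R a" if "k \<in> {1..K}" for k a
    unfolding R using that by (auto intro!: Max_ge)
  have cont: "continuous_on S ?R" for S
    unfolding R std_dist_def using K \<sigma>
    by (intro continuous_intros continuous_on_Max_family) (auto simp: less_imp_neq[symmetric])
  have 1: "1 \<in> {1..K}" using K by simp
  define r where "r = \<sigma> 1 * sqrt (?R (Y 1))"
  have R0: "?R (Y 1) \<ge> 1" using ge[OF 1, of "Y 1"] by (simp add: std_dist_def)
  have r: "r \<ge> 0" using \<sigma>[OF 1] R0 by (simp add: r_def)
  obtain a where a: "a \<in> cball (Y 1) r" "\<And>b. b \<in> cball (Y 1) r \<Longrightarrow> ?R a \<le> ?R b"
    using continuous_attains_inf[OF compact_cball _ cont, of "Y 1" r] r by auto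
  have min: "?R a \<le> ?R b" for b
  proof (cases "b \<in> cball (Y 1) r")
    case False
    then have "\<bar>Y 1 - b\<bar> > r" by (simp add: dist_real_def)
    then have "sqrt (?R (Y 1)) \<le> std_dist \<sigma> Y 1 b"
      using \<sigma>[OF 1] by (simp add: std_dist_def r_def field_simps)
    then have "?R (Y 1) \<le> (std_dist \<sigma> Y 1 b)\<^sup>2"
      using R0 by (simp add: real_sqrt_le_iff real_le_lsqrt sqrt_le_D)
    also have "\<dots> \<le> ?R b" using ge[OF 1, of b] by simp
    finally show ?thesis using a(2)[of "Y 1"] r by simp
  qed (use a in auto)
  have uniq: "b = c" if b: "\<And>x. ?R b \<le> ?R x" and c: "\<And>x. ?R c \<le> ?R x" for b c
  proof (rule ccontr)
    assume ne: "b \<noteq> c"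
    let ?m = "(b + c) / 2"
    have eq: "?R b = ?R c" using b[of c] c[of b] by simp
    have "(std_dist \<sigma> Y k ?m)\<^sup>2 < ?R b - 1" if k: "k \<in> {1..K}" for k
    proof -
      define u v where "u = (Y k - b) / \<sigma> k" and "v = (Y k - c) / \<sigma> k"
      have uv: "u \<noteq> v" using ne \<sigma>[OF k] by (auto simp: u_def v_def)
      have "(Y k - ?m) / \<sigma> k = (u + v) / 2"
        using \<sigma>[OF k] by (simp add: u_def v_def field_simps)
      then have "(std_dist \<sigma> Y k ?m)\<^sup>2 = ((u + v) / 2)\<^sup>2"
        by (metis std_dist_def power2_abs power_divide)
      also have "\<dots> = (u\<^sup>2 + v\<^sup>2) / 2 - ((u - v) / 2)\<^sup>2"
        by (simp add: power2_eq_square field_simps)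
      also have "\<dots> < (u\<^sup>2 + v\<^sup>2) / 2"
      proof -
        have "((u - v) / 2)\<^sup>2 > 0" using uv by simp
        then show ?thesis by linarith
      qed
      also have "\<dots> \<le> ?R b - 1"
        using ge[OF k, of b] ge[OF k, of c] eq
        by (simp add: std_dist_def u_def v_def power_divide)
      finally show ?thesis .
    qed
    then have "?R ?m < ?R b"
      unfolding R[of ?m] using K by (subst less_diff_eq[symmetric], subst Max_less_iff) auto
    then show False using b[of ?m] by simp
  qed
  show ?thesis
  proof (rule ex1I)
    show "is_arg_min ?R (\<lambda>_. True) a"
      using min by (auto simp: is_arg_min_def not_less)
    show "b = a" if "is_arg_min ?R (\<lambda>_. True) b" for b
      using that min by (intro uniq) (auto simp: is_arg_min_def not_less)
  qed
qed

lemma optimized_risk_attained: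
  assumes "K \<ge> 1" "\<And>k. k \<in> {1..K} \<Longrightarrow> \<sigma> k > 0"
  shows "optimized_risk K \<sigma> Y = simplex_risk K \<sigma> Y (optimal_headline K \<sigma> Y)"
    and "simplex_risk K \<sigma> Y (optimal_headline K \<sigma> Y) \<le> simplex_risk K \<sigma> Y a"
proof -
  have "is_arg_min (simplex_risk K \<sigma> Y) (\<lambda>_. True) (optimal_headline K \<sigma> Y)"
    unfolding optimal_headline_def by (rule theI'[OF optimal_headline_unique[OF assms]])
  then have le: "simplex_risk K \<sigma> Y (optimal_headline K \<sigma> Y) \<le> simplex_risk K \<sigma> Y b" for b
    by (simp add: is_arg_min_def not_less)
  show "simplex_risk K \<sigma> Y (optimal_headline K \<sigma> Y) \<le> simplex_risk K \<sigma> Y a" by (rule le)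
  show "optimized_risk K \<sigma> Y = simplex_risk K \<sigma> Y (optimal_headline K \<sigma> Y)"
    unfolding optimized_risk_def by (rule cInf_eq_minimum) (use le in auto)
qed

end

theory Submission
  imports Defs
begin

text \<open>
  A point \<open>x\<close> lies in every \<open>I\<^sub>k(t)\<close> iff its risk is at most \<open>t\<^sup>2 + 1\<close>; hence the common points
  at level \<open>c\<^sup>*\<close> are exactly the minimizers of the risk, and \<open>c\<^sup>*\<close> is the least level with a
  common point. By Helly's theorem on the line, the intervals meet iff they meet pairwise, which
  identifies \<open>c\<^sup>*\<close> with the maximal pair ratio. For \<open>K = 2\<close> and a prior \<open>(p, q)\<close>,
  \<open>\<rho> = p q (Y\<^sub>1 - Y\<^sub>2)\<^sup>2 / (p \<sigma>\<^sub>2\<^sup>2 + q \<sigma>\<^sub>1\<^sup>2)\<close> and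
  \<open>p \<sigma>\<^sub>2\<^sup>2 + q \<sigma>\<^sub>1\<^sup>2 - p q (\<sigma>\<^sub>1 + \<sigma>\<^sub>2)\<^sup>2 = (p \<sigma>\<^sub>2 - q \<sigma>\<^sub>1)\<^sup>2\<close>, so the maximum of \<open>\<rho>\<close> is
  \<open>((Y\<^sub>1 - Y\<^sub>2) / (\<sigma>\<^sub>1 + \<sigma>\<^sub>2))\<^sup>2\<close>, attained only when \<open>p \<sigma>\<^sub>2 = q \<sigma>\<^sub>1\<close>.
\<close>

section \<open>Distances, risk bounds and intersections of report intervals\<close>

lemma std_dist_le_iff:
  assumes "\<sigma> k > 0"
  shows "std_dist \<sigma> Y k x \<le> t \<longleftrightarrow> x \<in> report_interval \<sigma> Y k t"
  using assms by (auto simp: std_dist_def report_interval_def pos_divide_le_eq abs_le_iff)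

lemma simplex_risk_ge_1:
  assumes "K \<ge> 1"
  shows "simplex_risk K \<sigma> Y x \<ge> 1"
proof -
  have "0 \<le> (std_dist \<sigma> Y 1 x)\<^sup>2" by simp
  also have "\<dots> \<le> (MAX k\<in>{1..K}. (std_dist \<sigma> Y k x)\<^sup>2)"
    using assms by (intro Max_ge) auto
  finally show ?thesis
    using simplex_risk_is_max(3)[OF assms] by simp
qed

text \<open>This form turns nonemptiness into a comparison of two endpoints; when the intersection
  is a single point, both endpoints equal it.\<close>

lemma INT_report_interval:
  assumes "K \<ge> 1"
  shows "(\<Inter>k\<in>{1..K}. report_interval \<sigma> Y k t) =
    {(MAX k\<in>{1..K}. Y k - \<sigma> k * t) .. (MIN k\<in>{1..K}. Y k + \<sigma> k * t)}"
  using assms by (auto simp: report_interval_def mult.commute)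

section \<open>Sublevel sets of the risk and the reconciliation cost\<close>

context
  fixes K :: nat and Y \<sigma> :: "nat \<Rightarrow> real"
  assumes K: "K \<ge> 1" and \<sigma>: "\<forall>k\<in>{1..K}. \<sigma> k > 0"
begin

lemma optimized_risk_eq_simplex_risk:
  "optimized_risk K \<sigma> Y = simplex_risk K \<sigma> Y (optimal_headline K \<sigma> Y)"
  using K \<sigma> by (intro optimized_risk_attained(1)) auto

lemma simplex_risk_optimal_headline_le:
  "simplex_risk K \<sigma> Y (optimal_headline K \<sigma> Y) \<le> simplex_risk K \<sigma> Y a"
  using K \<sigma> by (intro optimized_risk_attained(2)) auto

text \<open>The risk is a maximum of squares plus 1, so a bound on it bounds each term separately;
  \<open>t \<ge> 0\<close> allows the squares to be dropped.\<close>

lemma simplex_risk_le_iff: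
  assumes "t \<ge> 0"
  shows "simplex_risk K \<sigma> Y x \<le> t\<^sup>2 + 1 \<longleftrightarrow> x \<in> (\<Inter>k\<in>{1..K}. report_interval \<sigma> Y k t)"
proof -
  have "simplex_risk K \<sigma> Y x \<le> t\<^sup>2 + 1 \<longleftrightarrow> (\<forall>k\<in>{1..K}. (std_dist \<sigma> Y k x)\<^sup>2 \<le> t\<^sup>2)"
    using K by (subst simplex_risk_is_max(3)) auto
  also have "\<dots> \<longleftrightarrow> (\<forall>k\<in>{1..K}. std_dist \<sigma> Y k x \<le> t)"
    using \<sigma> assms
    by (intro ball_cong refl power_mono_iff) (auto simp: std_dist_def less_imp_le)
  finally show ?thesis
    using \<sigma> by (simp add: std_dist_le_iff)
qed

text \<open>Uniqueness of the minimizer enters here; it makes the sublevel set at the optimal risk a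
  singleton.\<close>

lemma optimal_headline_eqI:
  assumes "simplex_risk K \<sigma> Y x \<le> optimized_risk K \<sigma> Y"
  shows "x = optimal_headline K \<sigma> Y"
proof -
  have "simplex_risk K \<sigma> Y x \<le> simplex_risk K \<sigma> Y a" for a
    using optimized_risk_eq_simplex_risk simplex_risk_optimal_headline_le[of a] assms by linarith
  then have "is_arg_min (simplex_risk K \<sigma> Y) (\<lambda>_. True) x"
    by (auto simp: is_arg_min_def not_less)
  then show ?thesis
    unfolding optimal_headline_def
    using K \<sigma> by (intro the1_equality[symmetric] optimal_headline_unique) auto
qed

text \<open>The risk is at least 1 everywhere, so squaring undoes the root in
  \<open>reconciliation_cost\<close>.\<close>

lemma optimized_risk_eq: "optimized_risk K \<sigma> Y = (reconciliation_cost K \<sigma> Y)\<^sup>2 + 1"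
  using simplex_risk_ge_1[OF K, of \<sigma> Y "optimal_headline K \<sigma> Y"]
  by (simp add: reconciliation_cost_def optimized_risk_eq_simplex_risk)

lemma reconciliation_cost_nonneg: "reconciliation_cost K \<sigma> Y \<ge> 0"
  using simplex_risk_ge_1[OF K, of \<sigma> Y "optimal_headline K \<sigma> Y"]
  by (simp add: reconciliation_cost_def optimized_risk_eq_simplex_risk)

lemma INT_report_interval_reconciliation_cost:
  "(\<Inter>k\<in>{1..K}. report_interval \<sigma> Y k (reconciliation_cost K \<sigma> Y)) = {optimal_headline K \<sigma> Y}"
proof -
  have "x \<in> (\<Inter>k\<in>{1..K}. report_interval \<sigma> Y k (reconciliation_cost K \<sigma> Y)) \<longleftrightarrow>
      simplex_risk K \<sigma> Y x \<le> optimized_risk K \<sigma> Y" for x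
    using simplex_risk_le_iff[OF reconciliation_cost_nonneg, of x] by (simp add: optimized_risk_eq)
  moreover have "simplex_risk K \<sigma> Y x \<le> optimized_risk K \<sigma> Y \<longleftrightarrow> x = optimal_headline K \<sigma> Y" for x
    using optimal_headline_eqI[of x] optimized_risk_eq_simplex_risk by auto
  ultimately show ?thesis by blast
qed

lemma reconciliation_cost_le:
  assumes "t \<ge> 0" "(\<Inter>k\<in>{1..K}. report_interval \<sigma> Y k t) \<noteq> {}"
  shows "reconciliation_cost K \<sigma> Y \<le> t"
proof -
  obtain x where "x \<in> (\<Inter>k\<in>{1..K}. report_interval \<sigma> Y k t)"
    using assms(2) by blast
  then have "simplex_risk K \<sigma> Y x \<le> t\<^sup>2 + 1"
    using simplex_risk_le_iff[OF assms(1), of x] by blast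
  then have "(reconciliation_cost K \<sigma> Y)\<^sup>2 \<le> t\<^sup>2"
    using optimized_risk_eq_simplex_risk simplex_risk_optimal_headline_le[of x]
      optimized_risk_eq by linarith
  then show ?thesis
    using assms(1) by (rule power2_le_imp_le)
qed

lemma optimal_headline_eq_Max_Min:
  shows "optimal_headline K \<sigma> Y = (MAX k\<in>{1..K}. Y k - \<sigma> k * reconciliation_cost K \<sigma> Y)"
    and "optimal_headline K \<sigma> Y = (MIN k\<in>{1..K}. Y k + \<sigma> k * reconciliation_cost K \<sigma> Y)"
  using INT_report_interval_reconciliation_cost
  unfolding INT_report_interval[OF K] atLeastAtMost_singleton_iff by auto

text \<open>Helly on the line: the largest left endpoint is at most the smallest right endpoint iff
  every left endpoint is at most every right endpoint.\<close>

lemma INT_report_interval_nonempty_iff: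
  assumes "t \<ge> 0"
  shows "(\<Inter>k\<in>{1..K}. report_interval \<sigma> Y k t) \<noteq> {} \<longleftrightarrow>
    (\<forall>j\<in>{1..K}. \<forall>k\<in>{1..K}. j < k \<longrightarrow> pair_ratio \<sigma> Y j k \<le> t)"
proof -
  have "(\<Inter>k\<in>{1..K}. report_interval \<sigma> Y k t) \<noteq> {} \<longleftrightarrow>
      (\<forall>j\<in>{1..K}. \<forall>k\<in>{1..K}. Y j - \<sigma> j * t \<le> Y k + \<sigma> k * t)"
    using K by (subst INT_report_interval[OF K]) auto
  \<comment> \<open>The endpoint inequalities for \<open>(j, k)\<close> and \<open>(k, j)\<close>
    together give the absolute value.\<close>
  also have "\<dots> \<longleftrightarrow> (\<forall>j\<in>{1..K}. \<forall>k\<in>{1..K}. \<bar>Y j - Y k\<bar> \<le> t * (\<sigma> j + \<sigma> k))"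
    (is "?L \<longleftrightarrow> ?R")
  proof
    show ?R if ?L
    proof (intro ballI)
      fix j k assume "j \<in> {1..K}" "k \<in> {1..K}"
      with that have "Y j - \<sigma> j * t \<le> Y k + \<sigma> k * t" "Y k - \<sigma> k * t \<le> Y j + \<sigma> j * t"
        by blast+
      then show "\<bar>Y j - Y k\<bar> \<le> t * (\<sigma> j + \<sigma> k)"
        by (simp add: abs_le_iff algebra_simps)
    qed
    show ?L if ?R
      using that by (auto simp: abs_le_iff algebra_simps)
  qed
  also have "\<dots> \<longleftrightarrow> (\<forall>j\<in>{1..K}. \<forall>k\<in>{1..K}. pair_ratio \<sigma> Y j k \<le> t)"
    using \<sigma> by (intro ball_cong refl) (simp add: pair_ratio_def pos_divide_le_eq add_pos_pos)
  \<comment> \<open>Restricting to \<open>j < k\<close> loses nothing: the ratio is symmetric, and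
    on the diagonal it is 0, hence at most \<open>t\<close>.\<close>
  also have "\<dots> \<longleftrightarrow> (\<forall>j\<in>{1..K}. \<forall>k\<in>{1..K}. j < k \<longrightarrow> pair_ratio \<sigma> Y j k \<le> t)"
  proof -
    have "pair_ratio \<sigma> Y j k = pair_ratio \<sigma> Y k j" "pair_ratio \<sigma> Y j j \<le> t" for j k
      using assms by (simp_all add: pair_ratio_def abs_minus_commute add.commute)
    then show ?thesis by (metis linorder_neqE_nat)
  qed
  finally show ?thesis .
qed

end

section \<open>The cost as the maximal pair ratio, and the pairs attaining it\<close>

lemma finite_pair_ratios: "finite {pair_ratio \<sigma> Y j k | j k. 1 \<le> j \<and> j < k \<and> k \<le> K}"
  by (rule finite_subset[of _ "(\<lambda>(j, k). pair_ratio \<sigma> Y j k) ` ({..K} \<times> {..K})"]) auto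

lemma reconciliation_cost_eq_max_pair_ratio:
  assumes K: "K \<ge> 2" and \<sigma>: "\<forall>k\<in>{1..K}. \<sigma> k > 0"
  shows "reconciliation_cost K \<sigma> Y = max_pair_ratio K \<sigma> Y"
proof -
  let ?S = "{pair_ratio \<sigma> Y j k | j k. 1 \<le> j \<and> j < k \<and> k \<le> K}"
  have K1: "K \<ge> 1" using K by simp
  \<comment> \<open>\<open>K \<ge> 2\<close> makes the set of ratios nonempty, so that its
    \<open>Max\<close> is meaningful.\<close>
  have ne: "pair_ratio \<sigma> Y 1 2 \<in> ?S"
    using K by (intro CollectI exI[of _ 1] exI[of _ 2]) auto
  have "0 \<le> pair_ratio \<sigma> Y 1 2"
    using K bspec[OF \<sigma>, of 1] bspec[OF \<sigma>, of 2] by (simp add: pair_ratio_def)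
  also have "\<dots> \<le> max_pair_ratio K \<sigma> Y"
    unfolding max_pair_ratio_def by (rule Max_ge[OF finite_pair_ratios ne])
  finally have nonneg: "0 \<le> max_pair_ratio K \<sigma> Y" .
  \<comment> \<open>Thus the maximal ratio is the least nonnegative level at which the intervals
    meet, which is also what characterizes the cost.\<close>
  have le_iff: "(\<Inter>k\<in>{1..K}. report_interval \<sigma> Y k t) \<noteq> {} \<longleftrightarrow> max_pair_ratio K \<sigma> Y \<le> t"
    if "t \<ge> 0" for t
    unfolding INT_report_interval_nonempty_iff[OF K1 \<sigma> that] max_pair_ratio_def
    using ne by (subst Max_le_iff[OF finite_pair_ratios]) (blast, fastforce)
  show ?thesis
  proof (rule antisym)
    show "reconciliation_cost K \<sigma> Y \<le> max_pair_ratio K \<sigma> Y"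
      using reconciliation_cost_le[OF K1 \<sigma> nonneg] le_iff[OF nonneg] by simp
    show "max_pair_ratio K \<sigma> Y \<le> reconciliation_cost K \<sigma> Y"
      using le_iff[OF reconciliation_cost_nonneg[OF K1 \<sigma>, of Y]]
        INT_report_interval_reconciliation_cost[OF K1 \<sigma>, of Y] by simp
  qed
qed

text \<open>The centers are exactly the sum of the two radii apart, so a common point is an endpoint
  of both intervals and divides the segment between the centers in the ratio
  \<open>\<sigma> j : \<sigma> k\<close>.\<close>

lemma touching_intervals:
  assumes \<sigma>: "\<sigma> j > 0" "\<sigma> k > 0"
    and eq: "pair_ratio \<sigma> Y j k = c"
    and x: "x \<in> report_interval \<sigma> Y j c" "x \<in> report_interval \<sigma> Y k c"
  shows "x = (\<sigma> k * Y j + \<sigma> j * Y k) / (\<sigma> j + \<sigma> k)"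
    and "c = std_dist \<sigma> Y j x" and "c = std_dist \<sigma> Y k x"
proof -
  have d: "\<bar>Y j - Y k\<bar> = c * \<sigma> j + c * \<sigma> k"
    using \<sigma> eq by (auto simp: pair_ratio_def field_simps)
  have xj: "\<bar>Y j - x\<bar> = c * \<sigma> j" and xk: "\<bar>Y k - x\<bar> = c * \<sigma> k"
    using x d by (auto simp: report_interval_def)
  then show "c = std_dist \<sigma> Y j x" "c = std_dist \<sigma> Y k x"
    using \<sigma> by (simp_all add: std_dist_def)
  \<comment> \<open>The distances from \<open>x\<close> to the centers add up to the distance
    between them, so \<open>x\<close> lies between the centers; the cases are their two
    orders.\<close>
  consider "Y j - x = c * \<sigma> j" "x - Y k = c * \<sigma> k" | "x - Y j = c * \<sigma> j" "Y k - x = c * \<sigma> k"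
    using xj xk d by linarith
  then have "\<sigma> k * (Y j - x) = \<sigma> j * (x - Y k)"
  proof cases
    case 1
    show ?thesis unfolding 1 by simp
  next
    case 2
    have "\<sigma> k * (x - Y j) = \<sigma> j * (Y k - x)" unfolding 2 by simp
    then show ?thesis by (simp add: algebra_simps)
  qed
  then have "x * (\<sigma> j + \<sigma> k) = \<sigma> k * Y j + \<sigma> j * Y k"
    by (simp add: algebra_simps)
  then show "x = (\<sigma> k * Y j + \<sigma> j * Y k) / (\<sigma> j + \<sigma> k)"
    using \<sigma> by (simp add: eq_divide_eq)
qed

section \<open>The least favorable prior for two reports\<close>

lemma atLeast_1_atMost_2: "{Suc 0..2} = {1, 2}"
  by auto

text \<open>Priors vanish off the index set, so a single number in the unit interval determines the
  whole function, and maximizing \<open>prior_risk\<close> becomes a one-variable problem.\<close>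

lemma prior_simplex_2:
  "l \<in> prior_simplex 2 \<longleftrightarrow> (\<exists>p\<in>{0..1}. l = (\<lambda>k. 0)(1 := p, 2 := 1 - p))"
proof
  assume l: "l \<in> prior_simplex 2"
  have "l 1 + l 2 = 1" "0 \<le> l 1" "0 \<le> l 2" "\<And>k. k \<noteq> 1 \<Longrightarrow> k \<noteq> 2 \<Longrightarrow> l k = 0"
    using l by (auto simp: prior_simplex_def atLeast_1_atMost_2)
  then show "\<exists>p\<in>{0..1}. l = (\<lambda>k. 0)(1 := p, 2 := 1 - p)"
    by (intro bexI[of _ "l 1"]) auto
next
  assume "\<exists>p\<in>{0..1}. l = (\<lambda>k. 0)(1 := p, 2 := 1 - p)"
  then show "l \<in> prior_simplex 2"
    by (auto simp: prior_simplex_def atLeast_1_atMost_2)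
qed

lemma two_point_denominator:
  fixes p s1 s2 :: real
  shows "p * s2\<^sup>2 + (1 - p) * s1\<^sup>2 = p * (1 - p) * (s1 + s2)\<^sup>2 + (p * s2 - (1 - p) * s1)\<^sup>2"
  by (simp add: power2_eq_square algebra_simps)

lemma two_point_denominator_pos:
  fixes p s1 s2 :: real
  assumes "p \<in> {0..1}" "s1 > 0" "s2 > 0"
  shows "p * s2\<^sup>2 + (1 - p) * s1\<^sup>2 > 0"
  \<comment> \<open>At \<open>p = 0\<close> only the second summand remains; otherwise the first is
    positive and the second nonnegative.\<close>
  using assms by (cases "p = 0") (auto intro!: add_pos_nonneg)

text \<open>Each point deviates from the weighted mean by the other point's share of the weight
  times the difference of the points.\<close>

lemma weighted_variance_two_points:
  fixes u v x y :: real
  assumes "u + v \<noteq> 0"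
  shows "u * (x - (u * x + v * y) / (u + v))\<^sup>2 + v * (y - (u * x + v * y) / (u + v))\<^sup>2 =
    u * v * (x - y)\<^sup>2 / (u + v)"
proof -
  have *: "x - (u * x + v * y) / (u + v) = v * (x - y) / (u + v)"
    "y - (u * x + v * y) / (u + v) = u * (y - x) / (u + v)"
    using assms by (simp_all add: field_simps)
  have "u * (v * (x - y))\<^sup>2 + v * (u * (y - x))\<^sup>2 = u * v * (x - y)\<^sup>2 * (u + v)"
    by (simp add: power2_eq_square algebra_simps)
  then show ?thesis
    unfolding * power_divide using assms
    by (simp add: power2_eq_square add_divide_distrib[symmetric])
qed

lemma prior_risk_2:
  assumes \<sigma>: "\<sigma> 1 > 0" "\<sigma> 2 > 0" and p: "p \<in> {0..1}"
  shows "prior_risk 2 \<sigma> Y ((\<lambda>k. 0)(1 := p, 2 := 1 - p)) =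
    p * (1 - p) * (Y 1 - Y 2)\<^sup>2 / (p * (\<sigma> 2)\<^sup>2 + (1 - p) * (\<sigma> 1)\<^sup>2)"
proof -
  \<comment> \<open>The prior weights divided by the variances: \<open>prior_action\<close> is the
    mean of \<open>Y 1\<close> and \<open>Y 2\<close> with these weights.\<close>
  define u v where "u = p / (\<sigma> 1)\<^sup>2" and "v = (1 - p) / (\<sigma> 2)\<^sup>2"
  let ?D = "p * (\<sigma> 2)\<^sup>2 + (1 - p) * (\<sigma> 1)\<^sup>2"
  have D: "?D > 0" by (rule two_point_denominator_pos[OF p \<sigma>])
  have uv: "u + v = ?D / ((\<sigma> 1)\<^sup>2 * (\<sigma> 2)\<^sup>2)"
    using \<sigma> by (simp add: u_def v_def field_simps)
  then have uv0: "u + v \<noteq> 0" using D \<sigma> by simp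
  have "prior_risk 2 \<sigma> Y ((\<lambda>k. 0)(1 := p, 2 := 1 - p)) =
      u * (Y 1 - (u * Y 1 + v * Y 2) / (u + v))\<^sup>2 + v * (Y 2 - (u * Y 1 + v * Y 2) / (u + v))\<^sup>2"
    by (simp add: prior_risk_def prior_action_def std_dist_def atLeast_1_atMost_2 u_def v_def power_divide)
  also have "\<dots> = u * v * (Y 1 - Y 2)\<^sup>2 / (u + v)"
    by (rule weighted_variance_two_points[OF uv0])
  also have "\<dots> = p * (1 - p) * (Y 1 - Y 2)\<^sup>2 / ?D"
    unfolding uv using \<sigma> D by (simp add: u_def v_def)
  finally show ?thesis .
qed

text \<open>A square over a positive denominator yields the upper bound on the prior risk and its
  equality case at once.\<close>

lemma prior_risk_2_gap:
  assumes \<sigma>: "\<sigma> 1 > 0" "\<sigma> 2 > 0" and p: "p \<in> {0..1}"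
  shows "((Y 1 - Y 2) / (\<sigma> 1 + \<sigma> 2))\<^sup>2 - prior_risk 2 \<sigma> Y ((\<lambda>k. 0)(1 := p, 2 := 1 - p)) =
    ((Y 1 - Y 2) * (p * \<sigma> 2 - (1 - p) * \<sigma> 1))\<^sup>2 /
      ((\<sigma> 1 + \<sigma> 2)\<^sup>2 * (p * (\<sigma> 2)\<^sup>2 + (1 - p) * (\<sigma> 1)\<^sup>2))"
proof -
  define D where "D = p * (\<sigma> 2)\<^sup>2 + (1 - p) * (\<sigma> 1)\<^sup>2"
  define S where "S = (\<sigma> 1 + \<sigma> 2)\<^sup>2"
  have D: "D > 0" unfolding D_def by (rule two_point_denominator_pos[OF p \<sigma>])
  have S: "S > 0" using \<sigma> by (simp add: S_def)
  \<comment> \<open>Replacing this square leaves an identity that treats \<open>D\<close> and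
    \<open>S\<close> as independent positive quantities.\<close>
  have E: "(p * \<sigma> 2 - (1 - p) * \<sigma> 1)\<^sup>2 = D - p * (1 - p) * S"
    using two_point_denominator[of p "\<sigma> 2" "\<sigma> 1"] by (simp add: D_def S_def)
  show ?thesis
    unfolding prior_risk_2[OF assms] power_divide power_mult_distrib E D_def[symmetric] S_def[symmetric]
    using D S by (simp add: field_simps)
qed

text \<open>The set equation expresses existence and uniqueness together.\<close>

lemma least_favorable_prior_2:
  assumes \<sigma>: "\<sigma> 1 > 0" "\<sigma> 2 > 0" and ne: "Y 1 \<noteq> Y 2"
  defines "p \<equiv> \<sigma> 1 / (\<sigma> 1 + \<sigma> 2)"
  shows "{l. least_favorable_prior 2 \<sigma> Y l} = {(\<lambda>k. 0)(1 := p, 2 := 1 - p)}"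
proof -
  let ?prior = "\<lambda>q. (\<lambda>k::nat. 0::real)(1 := q, 2 := 1 - q)"
  let ?\<rho> = "prior_risk 2 \<sigma> Y"
  let ?M = "((Y 1 - Y 2) / (\<sigma> 1 + \<sigma> 2))\<^sup>2"
  have p: "p \<in> {0..1}" using \<sigma> by (simp add: p_def)
  have zero_iff: "q * \<sigma> 2 - (1 - q) * \<sigma> 1 = 0 \<longleftrightarrow> q = p" for q
    using \<sigma> by (auto simp: p_def field_simps)
  have le: "?\<rho> (?prior q) \<le> ?M" and eq_iff: "?\<rho> (?prior q) = ?M \<longleftrightarrow> q = p" if q: "q \<in> {0..1}" for q
  proof -
    note D = two_point_denominator_pos[OF q \<sigma>]
    note gap = prior_risk_2_gap[OF \<sigma> q, of Y]
    have "0 \<le> ?M - ?\<rho> (?prior q)"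
      unfolding gap using D by (intro divide_nonneg_nonneg mult_nonneg_nonneg) auto
    then show "?\<rho> (?prior q) \<le> ?M" by simp
    \<comment> \<open>Since \<open>Y 1 \<noteq> Y 2\<close>, the gap can vanish only through the
      factor that depends on \<open>q\<close>.\<close>
    have "?M - ?\<rho> (?prior q) = 0 \<longleftrightarrow> q = p"
      unfolding gap using D \<sigma> ne zero_iff[of q] by simp
    then show "?\<rho> (?prior q) = ?M \<longleftrightarrow> q = p" by auto
  qed
  have "least_favorable_prior 2 \<sigma> Y l \<longleftrightarrow> l = ?prior p" for l
  proof
    assume "least_favorable_prior 2 \<sigma> Y l"
    then have l: "l \<in> prior_simplex 2" and max: "\<And>m. m \<in> prior_simplex 2 \<Longrightarrow> ?\<rho> m \<le> ?\<rho> l"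
      by (auto simp: least_favorable_prior_def is_arg_max_def not_less)
    obtain q where q: "q \<in> {0..1}" "l = ?prior q"
      using l prior_simplex_2 by blast
    have "?prior p \<in> prior_simplex 2"
      using p prior_simplex_2 by blast
    \<comment> \<open>Comparison with the candidate \<open>?prior p\<close>, whose risk is
      \<open>?M\<close>, forces equality in the upper bound.\<close>
    from max[OF this] have "?M \<le> ?\<rho> (?prior q)"
      using eq_iff[OF p] q(2) by simp
    with le[OF q(1)] have "q = p"
      using eq_iff[OF q(1)] by simp
    with q(2) show "l = ?prior p" by simp
  next
    assume l: "l = ?prior p"
    have max: "?\<rho> l = ?M"
      unfolding l using eq_iff[OF p] by blast
    have "?\<rho> m \<le> ?\<rho> l" if "m \<in> prior_simplex 2" for m
    proof -
      obtain q where q: "q \<in> {0..1}" "m = ?prior q"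
        using \<open>m \<in> prior_simplex 2\<close> prior_simplex_2 by blast
      show ?thesis
        unfolding max q(2) by (rule le[OF q(1)])
    qed
    moreover have "l \<in> prior_simplex 2"
      unfolding l prior_simplex_2 using p by blast
    ultimately show "least_favorable_prior 2 \<sigma> Y l"
      by (auto simp: least_favorable_prior_def is_arg_max_def not_less)
  qed
  then show ?thesis by blast
qed

section \<open>The closed-form solution for the simplex class\<close>

theorem proposition3:
  fixes K :: nat and Y \<sigma> :: "nat \<Rightarrow> real"
  assumes "K \<ge> 2" and "\<And>k. k \<in> {1..K} \<Longrightarrow> \<sigma> k > 0"
  shows "let \<theta> = optimal_headline K \<sigma> Y;
             R = optimized_risk K \<sigma> Y;
             c = reconciliation_cost K \<sigma> Y;
             C = {t. 0 \<le> t \<and> (\<Inter>k\<in>{1..K}. report_interval \<sigma> Y k t) \<noteq> {}}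
         in
           \<theta> = (MAX k\<in>{1..K}. Y k - \<sigma> k * c) \<and>
           \<theta> = (MIN k\<in>{1..K}. Y k + \<sigma> k * c) \<and>
           R = (max_pair_ratio K \<sigma> Y)\<^sup>2 + 1 \<and>
           (\<forall>j k. 1 \<le> j \<and> j < k \<and> k \<le> K \<and> pair_ratio \<sigma> Y j k = max_pair_ratio K \<sigma> Y \<longrightarrow>
              \<theta> = (\<sigma> k * Y j + \<sigma> j * Y k) / (\<sigma> j + \<sigma> k) \<and>
              c = std_dist \<sigma> Y j \<theta> \<and>
              c = std_dist \<sigma> Y k \<theta> \<and>
              c = \<bar>Y j - Y k\<bar> / (\<sigma> j + \<sigma> k)) \<and>
           (\<Inter>k\<in>{1..K}. report_interval \<sigma> Y k c) = {\<theta>} \<and>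
           c \<in> C \<and> (\<forall>t\<in>C. c \<le> t) \<and>
           (K = 2 \<longrightarrow>
              pair_ratio \<sigma> Y 1 2 = max_pair_ratio K \<sigma> Y \<and>
              \<theta> = (\<sigma> 2 * Y 1 + \<sigma> 1 * Y 2) / (\<sigma> 1 + \<sigma> 2) \<and>
              c = std_dist \<sigma> Y 1 \<theta> \<and>
              c = std_dist \<sigma> Y 2 \<theta> \<and>
              c = \<bar>Y 1 - Y 2\<bar> / (\<sigma> 1 + \<sigma> 2) \<and>
              R = (\<bar>Y 1 - Y 2\<bar> / (\<sigma> 1 + \<sigma> 2))\<^sup>2 + 1 \<and>
              (Y 1 \<noteq> Y 2 \<longrightarrow>
                 (let p = \<sigma> 1 / (\<sigma> 1 + \<sigma> 2) in
                    {l. least_favorable_prior K \<sigma> Y l} = {(\<lambda>k. 0)(1 := p, 2 := 1 - p)})))"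
proof -
  define \<theta> c where "\<theta> = optimal_headline K \<sigma> Y" and "c = reconciliation_cost K \<sigma> Y"
  have K: "K \<ge> 1" using assms(1) by simp
  have \<sigma>: "\<forall>k\<in>{1..K}. \<sigma> k > 0" using assms(2) by blast
  have c: "c = max_pair_ratio K \<sigma> Y"
    unfolding c_def by (rule reconciliation_cost_eq_max_pair_ratio[OF assms(1) \<sigma>])
  have R: "optimized_risk K \<sigma> Y = c\<^sup>2 + 1"
    unfolding c_def by (rule optimized_risk_eq[OF K \<sigma>])
  have INT: "(\<Inter>k\<in>{1..K}. report_interval \<sigma> Y k c) = {\<theta>}"
    unfolding c_def \<theta>_def by (rule INT_report_interval_reconciliation_cost[OF K \<sigma>])
  have pair: "\<theta> = (\<sigma> k * Y j + \<sigma> j * Y k) / (\<sigma> j + \<sigma> k)"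
    "c = std_dist \<sigma> Y j \<theta>" "c = std_dist \<sigma> Y k \<theta>" "c = \<bar>Y j - Y k\<bar> / (\<sigma> j + \<sigma> k)"
    if "1 \<le> j" "j < k" "k \<le> K" "pair_ratio \<sigma> Y j k = max_pair_ratio K \<sigma> Y" for j k
  proof -
    have jk: "j \<in> {1..K}" "k \<in> {1..K}" using that by auto
    have in_I: "\<theta> \<in> report_interval \<sigma> Y j c" "\<theta> \<in> report_interval \<sigma> Y k c"
      using INT jk by blast+
    have eq: "pair_ratio \<sigma> Y j k = c" using that c by simp
    show "\<theta> = (\<sigma> k * Y j + \<sigma> j * Y k) / (\<sigma> j + \<sigma> k)" "c = std_dist \<sigma> Y j \<theta>" "c = std_dist \<sigma> Y k \<theta>"
      using touching_intervals[OF assms(2)[OF jk(1)] assms(2)[OF jk(2)] eq in_I] by blast+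
    show "c = \<bar>Y j - Y k\<bar> / (\<sigma> j + \<sigma> k)"
      using eq by (simp add: pair_ratio_def)
  qed
  have pair_2: "pair_ratio \<sigma> Y 1 2 = max_pair_ratio K \<sigma> Y" if "K = 2"
  proof -
    \<comment> \<open>For two reports the maximum runs over the single pair
      \<open>(1, 2)\<close>.\<close>
    have "1 \<le> j \<and> j < k \<and> k \<le> K \<longleftrightarrow> j = 1 \<and> k = 2" for j k :: nat
      using that by auto
    then show ?thesis by (simp add: max_pair_ratio_def)
  qed
  have lfp: "{l. least_favorable_prior K \<sigma> Y l} =
      {(\<lambda>k. 0)(1 := \<sigma> 1 / (\<sigma> 1 + \<sigma> 2), 2 := 1 - \<sigma> 1 / (\<sigma> 1 + \<sigma> 2))}"
    if "K = 2" "Y 1 \<noteq> Y 2"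
    using least_favorable_prior_2[OF _ _ that(2), of \<sigma>] assms(2)[of 1] assms(2)[of 2] that(1) by simp
  have two: "\<theta> = (\<sigma> 2 * Y 1 + \<sigma> 1 * Y 2) / (\<sigma> 1 + \<sigma> 2) \<and> c = std_dist \<sigma> Y 1 \<theta> \<and>
      c = std_dist \<sigma> Y 2 \<theta> \<and> c = \<bar>Y 1 - Y 2\<bar> / (\<sigma> 1 + \<sigma> 2) \<and>
      optimized_risk K \<sigma> Y = (\<bar>Y 1 - Y 2\<bar> / (\<sigma> 1 + \<sigma> 2))\<^sup>2 + 1" if "K = 2"
    using pair[OF _ _ _ pair_2[OF that]] that R by auto
  show ?thesis
    unfolding Let_def \<theta>_def[symmetric] c_def[symmetric]
  proof (intro conjI allI impI ballI; (elim conjE)?)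
    show "\<theta> = (MAX k\<in>{1..K}. Y k - \<sigma> k * c)" "\<theta> = (MIN k\<in>{1..K}. Y k + \<sigma> k * c)"
      unfolding \<theta>_def c_def by (rule optimal_headline_eq_Max_Min[OF K \<sigma>])+
    show "c \<in> {t. 0 \<le> t \<and> (\<Inter>k\<in>{1..K}. report_interval \<sigma> Y k t) \<noteq> {}}"
      using INT reconciliation_cost_nonneg[OF K \<sigma>, of Y] by (simp add: c_def)
    show "c \<le> t" if "t \<in> {t. 0 \<le> t \<and> (\<Inter>k\<in>{1..K}. report_interval \<sigma> Y k t) \<noteq> {}}" for t
      unfolding c_def using reconciliation_cost_le[OF K \<sigma>] that by blast
    show "optimized_risk K \<sigma> Y = (max_pair_ratio K \<sigma> Y)\<^sup>2 + 1"
      using R c by simp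
  qed (fact INT pair pair_2 lfp | use two in blast)+
qed

end
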